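(* Let $\underline{\beta}=(\beta(1),\beta(2),\ldots,\beta(n))\in\mathbb{N}^n$. The number of regions $r(\mathcal{A})$ of the $\underline{\beta}$-extended Shi arrangement $\mathcal{A}$ is $$r(\mathcal{A})=\left(\sum_{j=1}^n(\beta(j)+1)+1\right)^{n-1}.$$
   Context: Here $\mathbb{N}$ includes $0$ and $V_{n-1}=\{x\in\mathbb{R}^n: x_1+\cdots+x_n=0\}$. The $\underline{\beta}$-extended Shi arrangement is the set of hyperplanes $$x_i-x_j=-\beta(i),-\beta(i)+1,\ldots,\beta(j)+1,\quad 1\le i<j\le n,$$ in $V_{n-1}$. Its regions are the connected components of the complement in $V_{n-1}$ of the union of these hyperplanes. *)

theory Defs
  imports "HOL-Analysis.Analysis"
begin

text \<open>
  The coordinates are indexed by an arbitrary finite linearly ordered type \<open>'n\<close> in place of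
  \<open>{1, \<dots>, n}\<close>, so \<open>n\<close> is \<open>CARD('n)\<close>; the order of \<open>'n\<close> gives the meaning of \<open>i < j\<close>.
\<close>

definition sum_zero_space :: "(real ^ 'n::finite) set" where
  "sum_zero_space = {x. (\<Sum>i\<in>UNIV. x $ i) = 0}"

definition diff_hyperplane :: "'n::finite \<Rightarrow> 'n \<Rightarrow> int \<Rightarrow> (real ^ 'n::finite) set" where
  "diff_hyperplane i j k = {x \<in> sum_zero_space. x $ i - x $ j = of_int k}"

definition extended_shi ::
    "('n::{finite,linorder} \<Rightarrow> nat) \<Rightarrow> (real ^ 'n::{finite,linorder}) set set" where
  "extended_shi \<beta> =
     {diff_hyperplane i j k | i j k. i < j \<and> k \<in> {- int (\<beta> i) .. int (\<beta> j) + 1}}"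

definition regions :: "(real ^ 'n::finite) set set \<Rightarrow> (real ^ 'n::finite) set set" where
  "regions \<A> = components (sum_zero_space - \<Union>\<A>)"

end

theory Submission
  imports Defs
begin

text \<open>
  A region is a set of points lying on the same sides of all hyperplanes: such a set is convex,
  hence connected, and no connected subset of the complement crosses a hyperplane. So the
  problem is to count the sign patterns realised by points off the hyperplanes, and for this the
  restriction to coordinate sum zero is immaterial, as translation along \<open>(1, \<dots>, 1)\<close> preserves
  all differences (\<open>card_regions_eq_sign_patterns\<close>).

  Sign patterns satisfy deletion--contraction (\<open>sign_patterns_insert\<close>): adding the hyperplane
  \<open>x\<^sub>j - x\<^sub>i = c\<close> creates one new pattern for each pattern realised on that hyperplane, where
  \<open>x\<^sub>j\<close> may be replaced by \<open>x\<^sub>i + c\<close>.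

  The extended Shi arrangement belongs to a family that is closed under this operation. View
  \<open>x\<^sub>u\<close> as the position of the left end of a block of length \<open>b\<^sub>u = \<beta>(u) + 1\<close>; among blocks at
  mutually integral distances, block \<open>v\<close> may follow block \<open>u\<close> only at distance at least \<open>b\<^sub>u\<close>,
  and only at distance at least \<open>b\<^sub>u + 1\<close> if \<open>(u, v)\<close> is an arc of a given digraph \<open>E\<close>. The Shi
  case is the digraph of all \<open>(u, v)\<close> with \<open>v < u\<close>. Adding one arc \<open>(i, j)\<close> adds one hyperplane,
  \<open>x\<^sub>j - x\<^sub>i = b\<^sub>i\<close>, on which block \<open>j\<close> sits directly behind block \<open>i\<close>; contracting glues the two
  into a block of length \<open>b\<^sub>i + b\<^sub>j\<close>, with the incoming arcs of \<open>i\<close> and the outgoing arcs of \<open>j\<close>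
  (\<open>sign_patterns_add_arc\<close>). The total length \<open>B\<close> does not change.

  Let \<open>x = B + 1\<close>, and write \<open>(x)\<^sub>p\<close> for the falling factorial. Without arcs, \<open>n\<close> blocks have
  \<open>(x)\<^sub>n / x\<close> patterns. This follows by induction on \<open>B\<close>: lengthening one block by a unit is the
  same as giving it arcs to all other blocks; the induction starts with unit blocks, the braid
  arrangement, which has \<open>n!\<close> patterns (\<open>sign_patterns_no_arcs\<close>). More generally, when the lowest
  \<open>p\<close> blocks have no arcs among them and all other pairs carry the arc from the larger to the
  smaller element, there are \<open>(x)\<^sub>p x\<^sup>n\<^sup>-\<^sup>p / x\<close> patterns: removing the arcs of the next block into these
  \<open>p\<close> blocks turns the claim into \<open>x (x)\<^sub>p = (x)\<^bsub>p+1\<^esub> + p (x)\<^sub>p\<close>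
  (\<open>sign_patterns_chain_over_antichain\<close>). The Shi arrangement is the case \<open>p = 0\<close>, with
  \<open>x\<^sup>n / x\<close> patterns.
\<close>

section \<open>Sign patterns and deletion--contraction\<close>

text \<open>
  A triple \<open>(i, j, k)\<close> stands for the hyperplane \<open>x\<^sub>i - x\<^sub>j = k\<close>. The same hyperplane is also
  \<open>(j, i, - k)\<close>, and \<open>(i, i, k)\<close> with \<open>k \<noteq> 0\<close> is an empty one; allowing both makes contraction a
  plain substitution on triples.
\<close>

definition generic_points :: "('a \<times> 'a \<times> int) set \<Rightarrow> ('a \<Rightarrow> real) set" where
  "generic_points D = {x. \<forall>(i, j, k) \<in> D. x i - x j \<noteq> of_int k}"

definition positive_side :: "('a \<times> 'a \<times> int) set \<Rightarrow> ('a \<Rightarrow> real) \<Rightarrow> ('a \<times> 'a \<times> int) set" where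
  "positive_side D x = {(i, j, k) \<in> D. x i - x j > of_int k}"

text \<open>
  At a generic point the positive sides determine the negative ones, so the set of hyperplanes with
  the point on their positive side encodes the whole sign vector.
\<close>

definition sign_patterns :: "('a \<times> 'a \<times> int) set \<Rightarrow> nat" where
  "sign_patterns D = card (positive_side D ` generic_points D)"

lemma card_image_cong_kernel:
  assumes "\<And>x y. x \<in> X \<Longrightarrow> y \<in> X \<Longrightarrow> f x = f y \<longleftrightarrow> g x = g y"
  shows "card (f ` X) = card (g ` X)"
proof -
  have "bij_betw (\<lambda>s. g (inv_into X f s)) (f ` X) (g ` X)"
  proof (rule bij_betw_imageI)
    show "inj_on (\<lambda>s. g (inv_into X f s)) (f ` X)"
      by (intro inj_onI) (metis assms f_inv_into_f inv_into_into)
    have "g (inv_into X f (f x)) = g x" if "x \<in> X" for x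
      using assms that by (metis f_inv_into_f imageI inv_into_into)
    then show "(\<lambda>s. g (inv_into X f s)) ` f ` X = g ` X"
      by (simp add: image_image)
  qed
  then show ?thesis by (rule bij_betw_same_card)
qed

lemma finite_positive_sides: "finite D \<Longrightarrow> finite (positive_side D ` X)"
  by (rule finite_subset[of _ "Pow D"]) (auto simp: positive_side_def)

lemma positive_side_eq_iff:
  "positive_side D x = positive_side D y \<longleftrightarrow>
    (\<forall>(i, j, k) \<in> D. x i - x j > of_int k \<longleftrightarrow> y i - y j > of_int k)"
  by (auto simp: positive_side_def set_eq_iff)

text \<open>
  The cell of \<open>x\<close> is open. Only finitely many distances \<open>\<bar>x\<^sub>u - x\<^sub>v - k\<bar>\<close> are to be respected, and a
  shift of one coordinate by \<open>t\<close> changes each of them by at most \<open>\<bar>t\<bar>\<close>.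
\<close>

lemma generic_perturbation:
  assumes "finite D" "x \<in> generic_points D"
  shows "\<exists>\<epsilon>>0. \<forall>t. \<bar>t\<bar> < \<epsilon> \<longrightarrow> x(j := x j + t) \<in> generic_points D \<and>
    positive_side D (x(j := x j + t)) = positive_side D x"
proof -
  have "\<forall>\<^sub>F \<epsilon> in at_right 0. \<forall>(u, v, k) \<in> D. \<epsilon> < \<bar>x u - x v - of_int k\<bar>"
    using assms unfolding generic_points_def
    by (intro eventually_ball_finite) (auto intro!: order_tendstoD(2)[OF tendsto_ident_at])
  then have "\<forall>\<^sub>F \<epsilon> in at_right (0::real). \<epsilon> > 0 \<and> (\<forall>(u, v, k) \<in> D. \<epsilon> < \<bar>x u - x v - of_int k\<bar>)"
    by (intro eventually_conj eventually_at_right_less)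
  then obtain \<epsilon> where \<epsilon>: "\<epsilon> > 0" "\<And>u v k. (u, v, k) \<in> D \<Longrightarrow> \<epsilon> < \<bar>x u - x v - of_int k\<bar>"
    using eventually_happens' trivial_limit_at_right_real by (smt (verit) case_prodD)
  have "x(j := x j + t) \<in> generic_points D \<and>
    positive_side D (x(j := x j + t)) = positive_side D x" if t: "\<bar>t\<bar> < \<epsilon>" for t
  proof -
    let ?y = "x(j := x j + t)"
    have close: "\<bar>(?y u - ?y v) - (x u - x v)\<bar> \<le> \<bar>t\<bar>" for u v by auto
    have same: "a \<noteq> d \<and> (a > d \<longleftrightarrow> c > d)"
      if "\<bar>a - c\<bar> \<le> \<bar>t\<bar>" "\<epsilon> < \<bar>c - d\<bar>" for a c d :: real
      using that t by linarith
    have "?y u - ?y v \<noteq> of_int k \<and> (?y u - ?y v > of_int k \<longleftrightarrow> x u - x v > of_int k)"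
      if "(u, v, k) \<in> D" for u v k
      using same[OF close \<epsilon>(2)[OF that]] .
    then show ?thesis
      unfolding positive_side_eq_iff generic_points_def by blast
  qed
  then show ?thesis using \<epsilon>(1) by blast
qed

text \<open>The substitution \<open>x\<^sub>j := x\<^sub>i + c\<close>, performed on the equation that the triple stands for.\<close>

fun contract_triple :: "'a \<Rightarrow> 'a \<Rightarrow> int \<Rightarrow> 'a \<times> 'a \<times> int \<Rightarrow> 'a \<times> 'a \<times> int" where
  "contract_triple j i c (u, v, k) =
    (if u = j then i else u, if v = j then i else v,
     k - (if u = j then c else 0) + (if v = j then c else 0))"

lemma sign_patterns_contract:
  fixes c :: int
  assumes "i \<noteq> j"
  shows "card (positive_side D ` {x \<in> generic_points D. x j - x i = of_int c}) =
    sign_patterns (contract_triple j i c ` D)"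
proof -
  let ?D = "contract_triple j i c ` D"
  let ?lift = "\<lambda>y::'a \<Rightarrow> real. y(j := y i + of_int c)"
  have gt: "?lift y u - ?lift y v > of_int k \<longleftrightarrow>
      (case contract_triple j i c (u, v, k) of (u', v', k') \<Rightarrow> y u' - y v' > of_int k')"
    and eq: "?lift y u - ?lift y v = of_int k \<longleftrightarrow>
      (case contract_triple j i c (u, v, k) of (u', v', k') \<Rightarrow> y u' - y v' = of_int k')"
    for y u v k by auto
  have gen: "?lift y \<in> generic_points D \<longleftrightarrow> y \<in> generic_points ?D" for y
    unfolding generic_points_def using eq by (fastforce simp del: contract_triple.simps)
  have "{x \<in> generic_points D. x j - x i = of_int c} = ?lift ` generic_points ?D"
  proof (intro set_eqI iffI)
    fix x assume x: "x \<in> {x \<in> generic_points D. x j - x i = of_int c}"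
    then have "?lift x = x" by (auto simp: fun_eq_iff)
    with x gen[of x] show "x \<in> ?lift ` generic_points ?D" by (metis (no_types, lifting) image_eqI mem_Collect_eq)
  next
    fix x assume "x \<in> ?lift ` generic_points ?D"
    then show "x \<in> {x \<in> generic_points D. x j - x i = of_int c}" using gen assms by auto
  qed
  moreover have "positive_side D (?lift y) = positive_side D (?lift z) \<longleftrightarrow>
      positive_side ?D y = positive_side ?D z" for y z
    unfolding positive_side_eq_iff using gt by (fastforce simp del: contract_triple.simps)
  ultimately show ?thesis
    unfolding sign_patterns_def by (simp add: image_image) (rule card_image_cong_kernel, blast)
qed

text \<open>
  Each pattern of \<open>D\<close> is realised strictly above or strictly below the new hyperplane (if on it,
  perturb), so the surplus after insertion counts the patterns realised on both sides. By convexity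
  of cells these are realised on the hyperplane; conversely, from a point on it one can
  move to either side within the cell.
\<close>

theorem sign_patterns_insert:
  fixes c :: int
  assumes fin: "finite D" and ij: "i \<noteq> j" and new: "(j, i, c) \<notin> D"
  shows "sign_patterns (insert (j, i, c) D) =
    sign_patterns D + sign_patterns (contract_triple j i c ` D)"
proof -
  let ?h = "(j, i, c)"
  let ?D = "insert ?h D"
  define Ap where "Ap = positive_side D ` {x \<in> generic_points D. x j - x i > of_int c}"
  define Am where "Am = positive_side D ` {x \<in> generic_points D. x j - x i < of_int c}"
  have finA: "finite Ap" "finite Am"
    unfolding Ap_def Am_def using fin by (simp_all add: finite_positive_sides)
  have "generic_points ?D = {x \<in> generic_points D. x j - x i > of_int c} \<union>
      {x \<in> generic_points D. x j - x i < of_int c}"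
    unfolding generic_points_def by (auto simp: neq_iff)
  moreover have "positive_side ?D ` {x \<in> generic_points D. x j - x i > of_int c} = insert ?h ` Ap"
    unfolding Ap_def image_image by (intro image_cong) (auto simp: positive_side_def)
  moreover have "positive_side ?D ` {x \<in> generic_points D. x j - x i < of_int c} = Am"
    unfolding Am_def by (intro image_cong) (auto simp: positive_side_def)
  ultimately have "sign_patterns ?D = card (insert ?h ` Ap \<union> Am)"
    unfolding sign_patterns_def by (simp add: image_Un)
  also have "\<dots> = card (insert ?h ` Ap) + card Am"
  proof (rule card_Un_disjoint)
    have "?h \<notin> s" if "s \<in> Am" for s using that by (auto simp: Am_def positive_side_def)
    then show "insert ?h ` Ap \<inter> Am = {}" by blast
  qed (use finA in auto)
  also have "card (insert ?h ` Ap) = card Ap"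
  proof (rule card_image)
    have "?h \<notin> s" if "s \<in> Ap" for s using that new by (auto simp: Ap_def positive_side_def)
    then show "inj_on (insert ?h) Ap" by (intro inj_onI) (metis insert_ident)
  qed
  also have "card Ap + card Am = card (Ap \<union> Am) + card (Ap \<inter> Am)"
    using finA by (rule card_Un_Int)
  also have "Ap \<union> Am = positive_side D ` generic_points D"
  proof
    show "Ap \<union> Am \<subseteq> positive_side D ` generic_points D" by (auto simp: Ap_def Am_def)
    show "positive_side D ` generic_points D \<subseteq> Ap \<union> Am"
    proof
      fix s assume "s \<in> positive_side D ` generic_points D"
      then obtain x where x: "x \<in> generic_points D" "s = positive_side D x" by blast
      show "s \<in> Ap \<union> Am"
      proof (cases "x j - x i = of_int c")
        case True
        from generic_perturbation[OF fin x(1), of j] obtain \<epsilon> where "\<epsilon> > 0" and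
          e: "\<And>t. \<bar>t\<bar> < \<epsilon> \<Longrightarrow> x(j := x j + t) \<in> generic_points D \<and>
            positive_side D (x(j := x j + t)) = positive_side D x" by blast
        with e[of "\<epsilon> / 2"] x True ij have "s \<in> Ap"
          unfolding Ap_def by (intro image_eqI[of _ _ "x(j := x j + \<epsilon> / 2)"]) auto
        then show ?thesis by simp
      next
        case False
        with x show ?thesis unfolding Ap_def Am_def by (auto simp: neq_iff)
      qed
    qed
  qed
  also have "Ap \<inter> Am = positive_side D ` {x \<in> generic_points D. x j - x i = of_int c}"
  proof (intro set_eqI iffI)
    fix s assume "s \<in> Ap \<inter> Am"
    then obtain x y where x: "x \<in> generic_points D" "x j - x i > of_int c" "s = positive_side D x"
      and y: "y \<in> generic_points D" "y j - y i < of_int c" "s = positive_side D y"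
      unfolding Ap_def Am_def by blast
    \<comment> \<open>The point where the segment from \<open>x\<close> to \<open>y\<close> meets the new hyperplane.\<close>
    define p where "p = x j - x i - of_int c"
    define q where "q = of_int c - (y j - y i)"
    have pq: "p > 0" "q > 0" using x y by (auto simp: p_def q_def)
    define a where "a = q / (p + q)"
    define b where "b = p / (p + q)"
    have ab: "a > 0" "b > 0" "a + b = 1"
      using pq by (auto simp: a_def b_def simp flip: add_divide_distrib)
    define z where "z u = a * x u + b * y u" for u
    have zdiff: "z u - z v - of_int k = a * (x u - x v - of_int k) + b * (y u - y v - of_int k)" for u v k
    proof -
      have "of_int k = a * of_int k + b * (of_int k :: real)"
        using ab(3) by (metis distrib_right mult_1)
      then show ?thesis by (simp add: z_def algebra_simps)
    qed
    have "a * p = b * q" by (simp add: a_def b_def)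
    then have z0: "z j - z i = of_int c" using zdiff[of j i c] by (simp add: p_def q_def algebra_simps)
    have "z u - z v \<noteq> of_int k \<and> (z u - z v > of_int k \<longleftrightarrow> x u - x v > of_int k)"
      if d: "(u, v, k) \<in> D" for u v k
    proof -
      have "positive_side D x = positive_side D y" using x(3) y(3) by simp
      then have same: "x u - x v > of_int k \<longleftrightarrow> y u - y v > of_int k"
        using d unfolding positive_side_eq_iff by blast
      have ne: "x u - x v \<noteq> of_int k" "y u - y v \<noteq> of_int k"
        using d x(1) y(1) unfolding generic_points_def by auto
      show ?thesis
      proof (cases "x u - x v > of_int k")
        case True
        then have "z u - z v - of_int k > 0"
          unfolding zdiff using same ab by (intro add_pos_pos mult_pos_pos) auto
        with True show ?thesis by auto
      next
        case False
        then have "z u - z v - of_int k < 0"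
          unfolding zdiff using same ne ab by (intro add_neg_neg mult_pos_neg) auto
        with False show ?thesis by auto
      qed
    qed
    then have "z \<in> generic_points D" "positive_side D z = positive_side D x"
      unfolding positive_side_eq_iff generic_points_def by blast+
    with z0 x(3) show "s \<in> positive_side D ` {x \<in> generic_points D. x j - x i = of_int c}"
      by blast
  next
    fix s assume "s \<in> positive_side D ` {x \<in> generic_points D. x j - x i = of_int c}"
    then obtain x where x: "x \<in> generic_points D" "x j - x i = of_int c" "s = positive_side D x"
      by blast
    from generic_perturbation[OF fin x(1), of j] obtain \<epsilon> where "\<epsilon> > 0" and
      e: "\<And>t. \<bar>t\<bar> < \<epsilon> \<Longrightarrow> x(j := x j + t) \<in> generic_points D \<and>
        positive_side D (x(j := x j + t)) = positive_side D x" by blast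
    have "s \<in> Ap"
      using \<open>\<epsilon> > 0\<close> e[of "\<epsilon> / 2"] x ij unfolding Ap_def
      by (intro image_eqI[of _ _ "x(j := x j + \<epsilon> / 2)"]) auto
    moreover have "s \<in> Am"
      using \<open>\<epsilon> > 0\<close> e[of "- \<epsilon> / 2"] x ij unfolding Am_def
      by (intro image_eqI[of _ _ "x(j := x j + (- \<epsilon> / 2))"]) auto
    ultimately show "s \<in> Ap \<inter> Am" by blast
  qed
  finally show ?thesis
    using sign_patterns_contract[OF ij, of D c] by (simp add: sign_patterns_def)
qed

text \<open>
  A canonical form for a set of triples: both orientations of every hyperplane, and no empty ones.
\<close>

definition hyperplanes_of :: "('a \<times> 'a \<times> int) set \<Rightarrow> ('a \<times> 'a \<times> int) set" where
  "hyperplanes_of D = {(i, j, k). i \<noteq> j \<and> ((i, j, k) \<in> D \<or> (j, i, - k) \<in> D)}"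

lemma sign_patterns_hyperplanes:
  assumes "\<And>i. (i, i, 0) \<notin> D"
  shows "sign_patterns D = sign_patterns (hyperplanes_of D)"
proof -
  let ?H = "hyperplanes_of D"
  have rev: "x i - x j = of_int (- k) \<longleftrightarrow> x j - x i = of_int k" for x :: "'a \<Rightarrow> real" and i j k
    by auto
  have gen: "generic_points D = generic_points ?H"
  proof (intro set_eqI iffI)
    fix x assume "x \<in> generic_points D"
    then show "x \<in> generic_points ?H"
      unfolding generic_points_def hyperplanes_of_def using rev by fastforce
  next
    fix x assume x: "x \<in> generic_points ?H"
    have "x i - x j \<noteq> of_int k" if d: "(i, j, k) \<in> D" for i j k
    proof (cases "i = j")
      case True
      then show ?thesis using d assms[of i] by auto
    next
      case False
      then show ?thesis using d x unfolding generic_points_def hyperplanes_of_def by auto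
    qed
    then show "x \<in> generic_points D" unfolding generic_points_def by auto
  qed
  have "positive_side D x = positive_side D y \<longleftrightarrow> positive_side ?H x = positive_side ?H y"
    if xy: "x \<in> generic_points D" "y \<in> generic_points D" for x y
  proof
    assume eq: "positive_side D x = positive_side D y"
    have "x i - x j > of_int k \<longleftrightarrow> y i - y j > of_int k" if h: "(i, j, k) \<in> ?H" for i j k
    proof (cases "(i, j, k) \<in> D")
      case True
      then show ?thesis using eq unfolding positive_side_eq_iff by blast
    next
      case False
      then have d: "(j, i, - k) \<in> D" using h by (auto simp: hyperplanes_of_def)
      then have "x j - x i > of_int (- k) \<longleftrightarrow> y j - y i > of_int (- k)"
        using eq unfolding positive_side_eq_iff by blast
      moreover have "x j - x i \<noteq> of_int (- k)" "y j - y i \<noteq> of_int (- k)"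
        using d xy unfolding generic_points_def by blast+
      ultimately show ?thesis by auto
    qed
    then show "positive_side ?H x = positive_side ?H y" unfolding positive_side_eq_iff by blast
  next
    assume eq: "positive_side ?H x = positive_side ?H y"
    have "x i - x j > of_int k \<longleftrightarrow> y i - y j > of_int k" if d: "(i, j, k) \<in> D" for i j k
    proof (cases "i = j")
      case False
      then have "(i, j, k) \<in> ?H" using d by (auto simp: hyperplanes_of_def)
      then show ?thesis using eq unfolding positive_side_eq_iff by blast
    qed simp
    then show "positive_side D x = positive_side D y" unfolding positive_side_eq_iff by blast
  qed
  then show ?thesis
    unfolding sign_patterns_def gen[symmetric] by (rule card_image_cong_kernel)
qed

lemma sign_patterns_cong:
  assumes "hyperplanes_of D = hyperplanes_of D'" "\<And>i. (i, i, 0) \<notin> D" "\<And>i. (i, i, 0) \<notin> D'"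
  shows "sign_patterns D = sign_patterns D'"
  using assms sign_patterns_hyperplanes by metis

section \<open>Gap arrangements\<close>

definition gap :: "('a \<Rightarrow> nat) \<Rightarrow> ('a \<times> 'a) set \<Rightarrow> 'a \<Rightarrow> 'a \<Rightarrow> int" where
  "gap b E u v = int (b u) + (if (u, v) \<in> E then 1 else 0)"

text \<open>
  Here \<open>gap b E u v\<close> is the least integral distance at which \<open>v\<close> may follow \<open>u\<close>. Thus
  \<open>x\<^sub>u - x\<^sub>v = k\<close> is forbidden for \<open>0 \<le> k < gap b E v u\<close>, where \<open>u\<close> follows \<open>v\<close>, and for
  \<open>0 \<le> - k < gap b E u v\<close>, where \<open>v\<close> follows \<open>u\<close>.
\<close>

definition gap_arrangement ::
    "'a set \<Rightarrow> ('a \<Rightarrow> nat) \<Rightarrow> ('a \<times> 'a) set \<Rightarrow> ('a \<times> 'a \<times> int) set" where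
  "gap_arrangement V b E =
    {(u, v, k). u \<in> V \<and> v \<in> V \<and> u \<noteq> v \<and> - gap b E u v < k \<and> k < gap b E v u}"

text \<open>
  Blocks \<open>i\<close> and \<open>j\<close>, glued in this order, form one block that keeps the name \<open>i\<close>. Its front is \<open>i\<close>,
  which receives the incoming arcs; its rear is \<open>j\<close>, which emits the outgoing ones.
\<close>

definition merge_arcs :: "'a \<Rightarrow> 'a \<Rightarrow> ('a \<times> 'a) set \<Rightarrow> ('a \<times> 'a) set" where
  "merge_arcs i j E = {(u, v). if u = i then (j, v) \<in> E else (u, v) \<in> E}"

lemma finite_gap_arrangement:
  assumes "finite V"
  shows "finite (gap_arrangement V b E)"
proof -
  have "gap_arrangement V b E \<subseteq>
      V \<times> V \<times> (\<Union>u\<in>V. \<Union>v\<in>V. {- gap b E u v <..< gap b E v u})"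
    by (auto simp: gap_arrangement_def) blast
  then show ?thesis by (rule finite_subset) (use assms in auto)
qed

lemma gap_arrangement_cong:
  assumes "\<And>u v. u \<in> V \<Longrightarrow> v \<in> V \<Longrightarrow> u \<noteq> v \<Longrightarrow> gap b E u v = gap b' E' u v"
  shows "gap_arrangement V b E = gap_arrangement V b' E'"
  using assms by (auto simp: gap_arrangement_def)

lemma hyperplanes_of_gap_arrangement [simp]:
  "hyperplanes_of (gap_arrangement V b E) = gap_arrangement V b E"
  by (auto simp: gap_arrangement_def hyperplanes_of_def)

lemma gap_arrangement_no_loop [simp]: "(i, i, k) \<notin> gap_arrangement V b E"
  by (auto simp: gap_arrangement_def)

text \<open>
  After \<open>x\<^sub>j := x\<^sub>i + b\<^sub>i\<close>, the values of \<open>x\<^sub>v - x\<^sub>i\<close> forbidden by \<open>i\<close> and by \<open>j\<close> are the open intervals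
  from \<open>- gap v i\<close> to \<open>gap i v\<close> and from \<open>b\<^sub>i - gap v j\<close> to \<open>b\<^sub>i + gap j v\<close>. Since block lengths are
  positive and gaps exceed them by at most 1, the two together contain the same integers as the
  interval from \<open>- gap v i\<close> to \<open>b\<^sub>i + gap j v\<close>, the one for the glued block. The second part says
  that the contraction is not degenerate: as \<open>(i, j)\<close> is no arc, \<open>x\<^sub>j - x\<^sub>i = b\<^sub>i\<close> was not yet
  forbidden.
\<close>

lemma contract_gap_arrangement:
  assumes ij: "i \<in> V" "j \<in> V" "i \<noteq> j" and new: "(i, j) \<notin> E"
    and pos: "\<And>v. v \<in> V \<Longrightarrow> b v > 0"
  shows "hyperplanes_of (contract_triple j i (int (b i)) ` gap_arrangement V b E) =
      gap_arrangement (V - {j}) (b(i := b i + b j)) (merge_arcs i j E)"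
    and "(w, w, 0) \<notin> contract_triple j i (int (b i)) ` gap_arrangement V b E"
proof -
  let ?D = "gap_arrangement V b E"
  let ?C = "contract_triple j i (int (b i)) ` ?D"
  let ?D' = "gap_arrangement (V - {j}) (b(i := b i + b j)) (merge_arcs i j E)"
  have mem: "(u, v, k) \<in> ?C \<longleftrightarrow> u \<noteq> j \<and> v \<noteq> j \<and> ((u, v, k) \<in> ?D \<or>
      u = i \<and> (j, v, k + int (b i)) \<in> ?D \<or> v = i \<and> (u, j, k - int (b i)) \<in> ?D)" 
    if "u \<noteq> v" for u v k
  proof
    assume "(u, v, k) \<in> ?C"
    then obtain u' v' k' where "(u', v', k') \<in> ?D" "(u, v, k) = contract_triple j i (int (b i)) (u', v', k')"
      by auto
    then show "u \<noteq> j \<and> v \<noteq> j \<and> ((u, v, k) \<in> ?D \<or>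
      u = i \<and> (j, v, k + int (b i)) \<in> ?D \<or> v = i \<and> (u, j, k - int (b i)) \<in> ?D)"
      using that ij by (auto split: if_splits)
  next
    assume R: "u \<noteq> j \<and> v \<noteq> j \<and> ((u, v, k) \<in> ?D \<or>
      u = i \<and> (j, v, k + int (b i)) \<in> ?D \<or> v = i \<and> (u, j, k - int (b i)) \<in> ?D)"
    have "contract_triple j i (int (b i)) (u, v, k) = (u, v, k)" if "u \<noteq> j" "v \<noteq> j"
      using that by simp
    moreover have "contract_triple j i (int (b i)) (j, v, k + int (b i)) = (i, v, k)" if "v \<noteq> j"
      using that by simp
    moreover have "contract_triple j i (int (b i)) (u, j, k - int (b i)) = (u, i, k)" if "u \<noteq> j"
      using that by simp
    ultimately show "(u, v, k) \<in> ?C" using R by (metis imageI)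
  qed
  have C_iff: "(u, v, k) \<in> ?C \<longleftrightarrow> (u, v, k) \<in> ?D'" if uv: "u \<noteq> v" for u v k
  proof -
    have bd: "gap b E u v \<ge> b u \<and> gap b E u v \<le> b u + 1" for u v by (auto simp: gap_def)
    show ?thesis
    proof (cases "u = i")
      case True
      have g: "gap (b(i := b i + b j)) (merge_arcs i j E) i v = b i + gap b E j v"
        "gap (b(i := b i + b j)) (merge_arcs i j E) v i = gap b E v i" if "v \<noteq> i"
        using that by (auto simp: gap_def merge_arcs_def)
      show ?thesis
        unfolding mem[OF uv] using True uv ij g pos[of i] pos[of j] pos[of v]
          bd[of i v] bd[of j v] bd[of v i] bd[of v j]
        unfolding gap_arrangement_def by auto
    next
      case False
      show ?thesis
      proof (cases "v = i")
        case True
        have g: "gap (b(i := b i + b j)) (merge_arcs i j E) i u = b i + gap b E j u"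
          "gap (b(i := b i + b j)) (merge_arcs i j E) u i = gap b E u i"
          using False by (auto simp: gap_def merge_arcs_def)
        show ?thesis
          unfolding mem[OF uv] using True False uv ij g pos[of i] pos[of j] pos[of u]
            bd[of i u] bd[of j u] bd[of u i] bd[of u j]
          unfolding gap_arrangement_def by auto
      next
        case v: False
        show ?thesis
          unfolding mem[OF uv] using v False uv
          unfolding gap_arrangement_def by (auto simp: gap_def merge_arcs_def)
      qed
    qed
  qed
  have "(u, v, k) \<in> hyperplanes_of ?C \<longleftrightarrow> (u, v, k) \<in> hyperplanes_of ?D'" for u v k
    unfolding hyperplanes_of_def mem_Collect_eq prod.case
    using C_iff[of u v k] C_iff[of v u "- k"] by blast
  then have "hyperplanes_of ?C = hyperplanes_of ?D'"
    unfolding set_eq_iff split_paired_All by blast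
  then show "hyperplanes_of ?C = ?D'" by simp
  show "(w, w, 0) \<notin> ?C"
    using new ij by (auto simp: gap_arrangement_def gap_def split: if_splits)
qed

theorem sign_patterns_add_arc:
  assumes "finite V" and ij: "i \<in> V" "j \<in> V" "i \<noteq> j" and new: "(i, j) \<notin> E"
    and pos: "\<And>v. v \<in> V \<Longrightarrow> b v > 0"
  shows "sign_patterns (gap_arrangement V b (insert (i, j) E)) =
    sign_patterns (gap_arrangement V b E) +
    sign_patterns (gap_arrangement (V - {j}) (b(i := b i + b j)) (merge_arcs i j E))"
proof -
  let ?D = "gap_arrangement V b E"
  have "hyperplanes_of (gap_arrangement V b (insert (i, j) E)) =
      hyperplanes_of (insert (j, i, int (b i)) ?D)"
    using ij new pos[of i] pos[of j] unfolding hyperplanes_of_gap_arrangement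
    by (auto simp: gap_arrangement_def gap_def hyperplanes_of_def split: if_splits)
  then have "sign_patterns (gap_arrangement V b (insert (i, j) E)) =
      sign_patterns (insert (j, i, int (b i)) ?D)"
    by (rule sign_patterns_cong) (use ij in auto)
  also have "\<dots> = sign_patterns ?D + sign_patterns (contract_triple j i (int (b i)) ` ?D)"
    using assms by (intro sign_patterns_insert finite_gap_arrangement)
      (auto simp: gap_arrangement_def gap_def)
  also have "sign_patterns (contract_triple j i (int (b i)) ` ?D) =
      sign_patterns (gap_arrangement (V - {j}) (b(i := b i + b j)) (merge_arcs i j E))"
    by (rule sign_patterns_cong; (unfold hyperplanes_of_gap_arrangement)?;
      (rule contract_gap_arrangement gap_arrangement_no_loop)?) (use assms in auto)
  finally show ?thesis .
qed

text \<open>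
  When several arcs leave the same \<open>i\<close>, gluing \<open>j\<close> behind \<open>i\<close> discards the other arcs out of
  \<open>i\<close>. The correction terms therefore do not depend on the order in which the arcs are added.
\<close>

corollary sign_patterns_add_star:
  assumes V: "finite V" "i \<in> V" "L \<subseteq> V - {i}" and new: "\<And>j. j \<in> L \<Longrightarrow> (i, j) \<notin> E"
    and pos: "\<And>v. v \<in> V \<Longrightarrow> b v > 0"
  shows "sign_patterns (gap_arrangement V b ({i} \<times> L \<union> E)) =
    sign_patterns (gap_arrangement V b E) +
    (\<Sum>j\<in>L. sign_patterns (gap_arrangement (V - {j}) (b(i := b i + b j)) (merge_arcs i j E)))"
proof -
  have "finite L" using V finite_subset by blast
  then show ?thesis using V(3) new
  proof (induction L)
    case (insert j L)
    have "gap_arrangement (V - {j}) (b(i := b i + b j)) (merge_arcs i j ({i} \<times> L \<union> E)) =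
        gap_arrangement (V - {j}) (b(i := b i + b j)) (merge_arcs i j E)"
      using insert.prems by (intro gap_arrangement_cong) (auto simp: gap_def merge_arcs_def)
    moreover have "{i} \<times> insert j L \<union> E = insert (i, j) ({i} \<times> L \<union> E)" by auto
    ultimately show ?case
      using insert sign_patterns_add_arc[of V i j "{i} \<times> L \<union> E" b] V pos
      by (auto simp del: fun_upd_apply)
  qed simp
qed

section \<open>Counting sign patterns of gap arrangements\<close>

lemma sign_patterns_empty: "sign_patterns {} = 1"
proof -
  have "positive_side {} ` generic_points {} = {{} :: ('a \<times> 'a \<times> int) set}"
    by (auto simp: positive_side_def generic_points_def)
  then show ?thesis by (simp add: sign_patterns_def)
qed

text \<open>
  A new point \<open>w\<close> is unconstrained at first, and each hyperplane \<open>x\<^sub>w = x\<^sub>l\<close> contracts to the braid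
  arrangement on the old points; so \<open>w\<close> multiplies the count by \<open>1 + card V\<close>.
\<close>

lemma sign_patterns_braid:
  assumes "finite V"
  shows "sign_patterns {(u, v, 0 :: int) |u v. u \<in> V \<and> v \<in> V \<and> u \<noteq> v} = fact (card V)"
  using assms
proof (induction V)
  case empty
  then show ?case using sign_patterns_empty by simp
next
  case (insert w V)
  let ?B = "\<lambda>V. {(u, v, 0 :: int) |u v. u \<in> V \<and> v \<in> V \<and> u \<noteq> v}"
  have finB: "finite (?B V)"
    by (rule finite_subset[of _ "V \<times> V \<times> {0}"]) (use insert(1) in auto)
  have star: "sign_patterns ({w} \<times> L \<times> {0} \<union> ?B V) = (1 + card L) * sign_patterns (?B V)"
    if "L \<subseteq> V" for L
  proof -
    have "finite L" using that insert(1) finite_subset by blast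
    then show ?thesis using that
    proof (induction L)
      case (insert l L)
      let ?D = "{w} \<times> L \<times> {0} \<union> ?B V"
      have w: "w \<notin> V" "w \<noteq> l" using \<open>w \<notin> V\<close> insert.prems by auto
      have "contract_triple w l 0 ` ({w} \<times> L \<times> {0}) \<subseteq> ?B V"
        using insert w by auto
      moreover have "contract_triple w l 0 ` ?B V = (\<lambda>d. d) ` ?B V"
        using w by (intro image_cong) auto
      ultimately have c: "contract_triple w l 0 ` ?D = ?B V"
        by (auto simp only: image_Un image_ident)
      have "{w} \<times> insert l L \<times> {0} \<union> ?B V = insert (w, l, 0) ?D" by auto
      then have "sign_patterns ({w} \<times> insert l L \<times> {0} \<union> ?B V) =
          sign_patterns ?D + sign_patterns (contract_triple w l 0 ` ?D)"
        using sign_patterns_insert[of ?D l w 0] insert w finB by auto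
      then show ?case using insert c by simp
    qed simp
  qed
  have "sign_patterns (?B (insert w V)) = sign_patterns ({w} \<times> V \<times> {0} \<union> ?B V)"
    using insert(2) by (intro sign_patterns_cong) (auto simp: hyperplanes_of_def)
  then show ?case using star[of V] insert by simp
qed

lemma sum_merge:
  fixes b :: "'a \<Rightarrow> nat"
  assumes "finite V" "i \<in> V" "j \<in> V" "i \<noteq> j"
  shows "sum (b(i := b i + b j)) (V - {j}) = sum b V"
proof -
  have "sum (b(i := b i + b j)) (V - {j}) = b i + b j + sum b (V - {j} - {i})"
    using assms by (subst sum.remove[of _ i]) (auto intro!: sum.cong)
  also have "\<dots> = sum b V"
    using assms by (simp add: sum.remove[of V j] sum.remove[of "V - {j}" i])
  finally show ?thesis .
qed

text \<open>
  The value is \<open>B (B - 1) \<dots> (B - n + 2)\<close> for \<open>n\<close> blocks of total length \<open>B\<close>. Shortening one block by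
  a unit and giving it arcs to all others leaves every gap unchanged, so the count obeys the
  recursion of falling factorials, \<open>(B)\<^sub>m = (B - 1)\<^sub>m + m (B - 1)\<^bsub>m-1\<^esub>\<close>, which is Pascal's rule for the
  binomial coefficients.
\<close>

lemma sign_patterns_no_arcs:
  assumes "finite V" "V \<noteq> {}" "\<And>v. v \<in> V \<Longrightarrow> b v > 0"
  shows "sign_patterns (gap_arrangement V b {}) =
    fact (card V - 1) * (sum b V choose (card V - 1))"
  using assms
proof (induction "sum b V" arbitrary: V b rule: less_induct)
  case less
  note V = \<open>finite V\<close> \<open>V \<noteq> {}\<close> and pos = less.prems(3)
  obtain m where m: "card V = Suc m" using V by (metis card_gt_0_iff gr0_implies_Suc)
  show ?case
  proof (cases "\<exists>i\<in>V. b i \<noteq> 1")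
    case True
    then obtain i where i: "i \<in> V" "b i > 1" using pos by (metis less_one linorder_neqE_nat neq0_conv)
    define b0 where "b0 = b(i := b i - 1)"
    have pos0: "b0 v > 0" if "v \<in> V" for v using that i pos by (auto simp: b0_def)
    have "sum b0 V = sum b (V - {i}) + (b i - 1)"
      using V i by (subst sum.remove[of _ i]) (auto simp: b0_def intro!: sum.cong)
    then have B: "sum b V = Suc (sum b0 V)" using V i by (simp add: sum.remove[of V i])
    have merged: "sign_patterns (gap_arrangement (V - {j}) (b0(i := b0 i + b0 j)) (merge_arcs i j {})) =
        fact (m - 1) * (sum b0 V choose (m - 1))" if j: "j \<in> V - {i}" for j
    proof -
      have s: "sum (b0(i := b0 i + b0 j)) (V - {j}) = sum b0 V"
        using V i j by (intro sum_merge) auto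
      have "merge_arcs i j {} = {}" by (auto simp: merge_arcs_def)
      moreover have "sign_patterns (gap_arrangement (V - {j}) (b0(i := b0 i + b0 j)) {}) =
          fact (card (V - {j}) - 1) * (sum (b0(i := b0 i + b0 j)) (V - {j}) choose (card (V - {j}) - 1))"
        by (rule less.hyps[of "b0(i := b0 i + b0 j)" "V - {j}"]; (unfold s)?) (use B V i j pos0 in auto)
      moreover have "card (V - {j}) - 1 = m - 1" using j m V by simp
      ultimately show ?thesis unfolding s by simp
    qed
    have "gap_arrangement V b {} = gap_arrangement V b0 ({i} \<times> (V - {i}) \<union> {})"
      using i by (intro gap_arrangement_cong) (auto simp: gap_def b0_def)
    then have "sign_patterns (gap_arrangement V b {}) = sign_patterns (gap_arrangement V b0 {}) +
        (\<Sum>j\<in>V - {i}. fact (m - 1) * (sum b0 V choose (m - 1)))"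
      using sign_patterns_add_star[of V i "V - {i}" "{}" b0] V i pos0 merged
      by (simp del: fun_upd_apply)
    also have "\<dots> = fact m * (sum b0 V choose m) + m * (fact (m - 1) * (sum b0 V choose (m - 1)))"
      using less.hyps[of b0 V] B V pos0 m i by simp
    also have "\<dots> = fact m * (sum b V choose m)"
      unfolding B by (cases m) (simp_all add: algebra_simps)
    finally show ?thesis using m by simp
  next
    case False
    then have b: "\<And>v. v \<in> V \<Longrightarrow> b v = 1" by auto
    then have "gap_arrangement V b {} = {(u, v, 0) |u v. u \<in> V \<and> v \<in> V \<and> u \<noteq> v}"
      by (auto simp: gap_arrangement_def gap_def)
    then have "sign_patterns (gap_arrangement V b {}) = fact (card V)"
      using sign_patterns_braid[OF V(1)] by simp
    moreover have "sum b V = card V" using b by simp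
    ultimately show ?thesis using m by simp
  qed
qed

text \<open>The identity \<open>(x)\<^bsub>p+1\<^esub> + p (x)\<^sub>p = x (x)\<^sub>p\<close>, with \<open>(x)\<^sub>p = p! (x choose p)\<close>.\<close>

lemma falling_factorial_step:
  fixes x p :: nat
  shows "fact (Suc p) * (x choose Suc p) + p * (fact p * (x choose p)) = x * (fact p * (x choose p))"
proof -
  have "Suc p * (x choose Suc p) = (x - p) * (x choose p)"
    by (metis binomial_absorb_comp binomial_absorption)
  moreover have "fact (Suc p) * (x choose Suc p) = fact p * (Suc p * (x choose Suc p))"
    by (simp only: fact_Suc of_nat_id mult_ac)
  ultimately have "fact (Suc p) * (x choose Suc p) = (x - p) * (fact p * (x choose p))"
    by (simp only: mult_ac)
  then show ?thesis
    by (cases "p \<le> x") (simp_all only: le_add_diff_inverse2 binomial_eq_0 not_le mult_0_right add_0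
        flip: add_mult_distrib)
qed

text \<open>
  The claim is reduced to fewer blocks and to the same blocks with a larger antichain \<open>P\<close>.
  Let \<open>i\<close> be the least element above \<open>P\<close>. Without its arcs into \<open>P\<close> it joins the antichain;
  gluing some \<open>j \<in> P\<close> behind it yields a block with no outgoing arcs that is below the same
  elements as before, so it replaces \<open>j\<close> in the antichain, now with one block less. Both
  arrangements are again of the same kind.
\<close>

lemma sign_patterns_chain_over_antichain:
  fixes V :: "'a::linorder set"
  assumes "finite V" "V \<noteq> {}" "\<And>v. v \<in> V \<Longrightarrow> b v > 0"
    and "P \<subseteq> V" "\<And>u v. u \<in> P \<Longrightarrow> v \<in> V - P \<Longrightarrow> u < v"
  shows "(sum b V + 1) * sign_patterns (gap_arrangement V b {(u, v). v < u \<and> u \<notin> P}) =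
    fact (card P) * ((sum b V + 1) choose card P) * (sum b V + 1) ^ (card V - card P)"
  using assms
  \<comment> \<open>Gluing lowers \<open>card V\<close> but keeps \<open>card P\<close>; joining raises \<open>card P\<close>, which is at most \<open>card V\<close>.\<close>
proof (induction "2 * card V - card P" arbitrary: V b P rule: less_induct)
  case less
  note V = \<open>finite V\<close> \<open>V \<noteq> {}\<close> and pos = less.prems(3) and P = \<open>P \<subseteq> V\<close> less.prems(5)
  obtain m where m: "card V = Suc m" using V by (metis card_gt_0_iff gr0_implies_Suc)
  let ?x = "sum b V + 1"
  show ?case
  proof (cases "P = V")
    case True
    have "gap_arrangement V b {(u, v). v < u \<and> u \<notin> P} = gap_arrangement V b {}"
      using True by (intro gap_arrangement_cong) (auto simp: gap_def)
    then have "?x * sign_patterns (gap_arrangement V b {(u, v). v < u \<and> u \<notin> P}) =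
        Suc (sum b V) * (fact m * (sum b V choose m))"
      using sign_patterns_no_arcs[of V b] V pos m by simp
    also have "\<dots> = fact m * (Suc (sum b V) * (sum b V choose m))"
      by (simp only: mult.left_commute)
    also have "\<dots> = fact m * ((Suc (sum b V) choose Suc m) * Suc m)"
      by (simp only: Suc_times_binomial_eq)
    also have "\<dots> = fact (Suc m) * (Suc (sum b V) choose Suc m)" by (simp add: algebra_simps)
    finally show ?thesis using True m by simp
  next
    case False
    define i where "i = Min (V - P)"
    have ne: "V - P \<noteq> {}" "finite (V - P)" using False P V by auto
    have i: "i \<in> V" "i \<notin> P" using Min_in[OF ne(2,1)] by (auto simp: i_def)
    have i_least: "i \<le> v" if "v \<in> V - P" for v using that ne by (simp add: i_def)
    have finP: "finite P" using P V finite_subset by blast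
    have cP: "card P < card V" using i P V by (metis psubsetI psubset_card_mono)
    define q where "q = card V - card P - 1"
    have q: "card V - card P = Suc q" using cP by (simp add: q_def)
    let ?E = "{(u, v). v < u \<and> u \<notin> insert i P}"
    have E: "gap_arrangement V b {(u, v). v < u \<and> u \<notin> P} = gap_arrangement V b ({i} \<times> P \<union> ?E)"
    proof -
      have "v < i \<longleftrightarrow> v \<in> P" if "v \<in> V" for v
        using that i P(2)[of v i] i_least[of v] by (metis DiffI leD)
      then show ?thesis using i by (intro gap_arrangement_cong) (auto simp: gap_def)
    qed
    have absorbed: "?x * sign_patterns (gap_arrangement V b ?E) =
        fact (Suc (card P)) * (?x choose Suc (card P)) * ?x ^ q"
    proof -
      have "u < v" if "u \<in> insert i P" "v \<in> V - insert i P" for u v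
        using that P(2) i_least[of v] by (auto simp: order.strict_iff_order)
      moreover have "2 * card V - card (insert i P) < 2 * card V - card P"
        using i finP cP by simp
      ultimately have "?x * sign_patterns (gap_arrangement V b ?E) = fact (card (insert i P)) *
          (?x choose card (insert i P)) * ?x ^ (card V - card (insert i P))"
        using V pos P(1) i(1) by (intro less.hyps) auto
      then show ?thesis using i(2) finP by (simp add: q_def)
    qed
    have merged: "?x * sign_patterns (gap_arrangement (V - {j}) (b(i := b i + b j)) (merge_arcs i j ?E)) =
        fact (card P) * (?x choose card P) * ?x ^ q" if j: "j \<in> P" for j
    proof -
      let ?P = "insert i P - {j}"
      have ij: "i \<noteq> j" "j \<in> V" using i j P by auto
      have "gap_arrangement (V - {j}) (b(i := b i + b j)) (merge_arcs i j ?E) =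
          gap_arrangement (V - {j}) (b(i := b i + b j)) {(u, v). v < u \<and> u \<notin> ?P}"
        using i j ij by (intro gap_arrangement_cong) (auto simp: gap_def merge_arcs_def)
      moreover have cards: "card ?P = card P" "card (V - {j}) = card V - 1"
        using i j ij finP V by auto
      moreover have "(sum (b(i := b i + b j)) (V - {j}) + 1) *
            sign_patterns (gap_arrangement (V - {j}) (b(i := b i + b j)) {(u, v). v < u \<and> u \<notin> ?P}) =
          fact (card ?P) * ((sum (b(i := b i + b j)) (V - {j}) + 1) choose card ?P) *
            (sum (b(i := b i + b j)) (V - {j}) + 1) ^ (card (V - {j}) - card ?P)"
      proof (rule less.hyps)
        show "2 * card (V - {j}) - card ?P < 2 * card V - card P"
          using cards cP by simp
        show "u < v" if "u \<in> ?P" "v \<in> V - {j} - ?P" for u v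
          using that P(2) i_least[of v] by (auto simp: order.strict_iff_order)
      qed (use V pos P(1) i ij in auto)
      moreover have "sum (b(i := b i + b j)) (V - {j}) = sum b V"
        using V i ij by (intro sum_merge) auto
      moreover have "card V - 1 - card P = q" by (simp add: q_def)
      ultimately show ?thesis by (simp only:)
    qed
    have "sign_patterns (gap_arrangement V b ({i} \<times> P \<union> ?E)) = sign_patterns (gap_arrangement V b ?E) +
        (\<Sum>j\<in>P. sign_patterns (gap_arrangement (V - {j}) (b(i := b i + b j)) (merge_arcs i j ?E)))"
      by (rule sign_patterns_add_star) (use V i P(1) pos in auto)
    then have "?x * sign_patterns (gap_arrangement V b {(u, v). v < u \<and> u \<notin> P}) =
        ?x * sign_patterns (gap_arrangement V b ?E) +
        (\<Sum>j\<in>P. ?x * sign_patterns (gap_arrangement (V - {j}) (b(i := b i + b j)) (merge_arcs i j ?E)))"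
      unfolding E by (simp only: add_mult_distrib2 sum_distrib_left)
    also have "\<dots> = (fact (Suc (card P)) * (?x choose Suc (card P)) +
        card P * (fact (card P) * (?x choose card P))) * ?x ^ q"
      using absorbed merged by (simp add: add_mult_distrib)
    also have "\<dots> = ?x * (fact (card P) * (?x choose card P)) * ?x ^ q"
      by (simp only: falling_factorial_step)
    also have "\<dots> = fact (card P) * (?x choose card P) * ?x ^ (card V - card P)"
      unfolding q by (simp only: power_Suc mult_ac)
    finally show ?thesis .
  qed
qed

lemma sign_patterns_shi:
  fixes b :: "'a::linorder \<Rightarrow> nat"
  assumes "finite V" "V \<noteq> {}" "\<And>v. v \<in> V \<Longrightarrow> b v > 0"
  shows "sign_patterns (gap_arrangement V b {(u, v). v < u}) = (sum b V + 1) ^ (card V - 1)"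
proof -
  have "card V \<noteq> 0" using assms by simp
  then have power: "(sum b V + 1) ^ card V = (sum b V + 1) * (sum b V + 1) ^ (card V - 1)"
    by (simp add: power_eq_if)
  have "(sum b V + 1) * sign_patterns (gap_arrangement V b {(u, v). v < u}) =
      (sum b V + 1) * (sum b V + 1) ^ (card V - 1)"
    using sign_patterns_chain_over_antichain[of V b "{}", OF assms] power by simp
  then show ?thesis by (simp only: mult_cancel1) simp
qed

section \<open>Regions as sign patterns\<close>

text \<open>
  The set of points with the sign pattern of \<open>x\<close> is convex, hence lies in the component; and by the
  intermediate value property no \<open>x\<^sub>i - x\<^sub>j - k\<close> changes sign within a connected set that avoids
  its zeros.
\<close>

lemma connected_component_set_complement:
  fixes D :: "('n::finite \<times> 'n \<times> int) set"
  defines "S \<equiv> {x \<in> sum_zero_space. ($) x \<in> generic_points D}"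
  assumes x: "x \<in> S"
  shows "connected_component_set S x = {y \<in> S. positive_side D (($) y) = positive_side D (($) x)}"
    (is "_ = ?C")
proof
  have side: "u $ i - u $ j > of_int k \<longleftrightarrow> x $ i - x $ j > of_int k"
    if "u \<in> ?C" "(i, j, k) \<in> D" for u i j k
    using that unfolding positive_side_eq_iff by blast
  have "convex ?C"
  proof (rule convexI)
    fix u v :: "real ^ 'n" and s t :: real
    assume u: "u \<in> ?C" and v: "v \<in> ?C" and st: "0 \<le> s" "0 \<le> t" "s + t = 1"
    let ?w = "s *\<^sub>R u + t *\<^sub>R v"
    have "(\<Sum>i\<in>UNIV. ?w $ i) = s * (\<Sum>i\<in>UNIV. u $ i) + t * (\<Sum>i\<in>UNIV. v $ i)"
      by (simp add: sum.distrib sum_distrib_left)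
    then have zero: "?w \<in> sum_zero_space"
      using u v by (simp add: S_def sum_zero_space_def)
    have "?w $ i - ?w $ j \<noteq> of_int k \<and> (?w $ i - ?w $ j > of_int k \<longleftrightarrow> x $ i - x $ j > of_int k)"
      if d: "(i, j, k) \<in> D" for i j k
    proof -
      have "of_int k = s * of_int k + t * (of_int k :: real)"
        using st(3) by (metis distrib_right mult_1)
      then have eq: "?w $ i - ?w $ j - of_int k =
          s * (u $ i - u $ j - of_int k) + t * (v $ i - v $ j - of_int k)"
        by (simp add: algebra_simps)
      have ne: "u $ i - u $ j \<noteq> of_int k" "v $ i - v $ j \<noteq> of_int k"
        using u v d unfolding S_def generic_points_def by auto
      have st': "s > 0 \<or> t > 0" using st by linarith
      show ?thesis
      proof (cases "x $ i - x $ j > of_int k")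
        case True
        then have "u $ i - u $ j - of_int k > 0" "v $ i - v $ j - of_int k > 0"
          using side[OF u d] side[OF v d] by auto
        then have "?w $ i - ?w $ j - of_int k > 0"
          unfolding eq using st st' by (metis add_pos_nonneg add_nonneg_pos mult_pos_pos mult_nonneg_nonneg less_imp_le)
        with True show ?thesis by auto
      next
        case False
        then have "u $ i - u $ j - of_int k < 0" "v $ i - v $ j - of_int k < 0"
          using side[OF u d] side[OF v d] ne by auto
        then have "?w $ i - ?w $ j - of_int k < 0"
          unfolding eq using st st' by (metis add_neg_nonpos add_nonpos_neg mult_pos_neg mult_nonneg_nonpos less_imp_le)
        with False show ?thesis by auto
      qed
    qed
    then show "?w \<in> ?C"
      using zero unfolding S_def positive_side_eq_iff generic_points_def by blast
  qed
  then show "?C \<subseteq> connected_component_set S x"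
    using x by (intro connected_component_maximal convex_connected) auto
next
  let ?K = "connected_component_set S x"
  have KS: "?K \<subseteq> S" by (rule connected_component_subset)
  have "y $ i - y $ j > of_int k \<longleftrightarrow> x $ i - x $ j > of_int k"
    if y: "y \<in> ?K" and d: "(i, j, k) \<in> D" for y i j k
  proof -
    let ?f = "\<lambda>z::real ^ 'n. z $ i - z $ j"
    have "connected (?f ` ?K)"
      by (intro connected_continuous_image continuous_intros) auto
    moreover have "?f y \<in> ?f ` ?K" "?f x \<in> ?f ` ?K" using x y by auto
    moreover have "of_int k \<notin> ?f ` ?K"
      using KS d unfolding S_def generic_points_def by force
    ultimately show ?thesis
      using connectedD_interval[of "?f ` ?K" "?f x" "?f y" "of_int k"]
        connectedD_interval[of "?f ` ?K" "?f y" "?f x" "of_int k"] by (meson linear not_less)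
  qed
  then show "?K \<subseteq> ?C"
    using KS unfolding positive_side_eq_iff by blast
qed

text \<open>
  Subtracting the mean from all coordinates moves any point into the sum-zero space and keeps its
  sign pattern.
\<close>

theorem card_regions_eq_sign_patterns:
  fixes D :: "('n::finite \<times> 'n \<times> int) set"
  shows "card (regions ((\<lambda>(i, j, k). diff_hyperplane i j k) ` D)) = sign_patterns D"
proof -
  define S where "S = {x \<in> sum_zero_space. ($) x \<in> generic_points D}"
  have "sum_zero_space - \<Union> ((\<lambda>(i, j, k). diff_hyperplane i j k) ` D) = S"
    unfolding S_def generic_points_def diff_hyperplane_def by fastforce
  then have "card (regions ((\<lambda>(i, j, k). diff_hyperplane i j k) ` D)) =
      card (connected_component_set S ` S)"
    by (simp add: regions_def components_def)
  also have "\<dots> = card ((\<lambda>x. positive_side D (($) x)) ` S)"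
  proof (rule card_image_cong_kernel)
    fix x y assume xy: "x \<in> S" "y \<in> S"
    show "connected_component_set S x = connected_component_set S y \<longleftrightarrow>
        positive_side D (($) x) = positive_side D (($) y)"
      using connected_component_set_complement[of x D] connected_component_set_complement[of y D] xy
      unfolding S_def[symmetric] by auto
  qed
  also have "(\<lambda>x. positive_side D (($) x)) ` S = positive_side D ` generic_points D"
  proof
    show "(\<lambda>x. positive_side D (($) x)) ` S \<subseteq> positive_side D ` generic_points D"
      by (auto simp: S_def)
    show "positive_side D ` generic_points D \<subseteq> (\<lambda>x. positive_side D (($) x)) ` S"
    proof (rule image_subsetI)
      fix x assume x: "x \<in> generic_points D"
      define y :: "real ^ 'n" where "y = (\<chi> i. x i - (\<Sum>j\<in>UNIV. x j) / CARD('n))"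
      have "y \<in> sum_zero_space" by (simp add: y_def sum_zero_space_def sum_subtractf)
      moreover have "($) y \<in> generic_points D" "positive_side D (($) y) = positive_side D x"
        using x by (simp_all add: y_def generic_points_def positive_side_def)
      ultimately show "positive_side D x \<in> (\<lambda>x. positive_side D (($) x)) ` S"
        unfolding S_def by (metis (mono_tags, lifting) image_eqI mem_Collect_eq)
    qed
  qed
  finally show ?thesis by (simp add: sign_patterns_def)
qed

theorem theorem6p10:
  fixes \<beta> :: "'n::{finite,linorder} \<Rightarrow> nat"
  shows "card (regions (extended_shi \<beta>)) =
    ((\<Sum>j\<in>UNIV. (\<beta> j + 1)) + 1) ^ (CARD('n) - 1)"
proof -
  let ?D = "{(i, j, k). i < j \<and> k \<in> {- int (\<beta> i) .. int (\<beta> j) + 1}}"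
  let ?G = "gap_arrangement UNIV (\<lambda>j. \<beta> j + 1) {(u, v). v < u}"
  have "extended_shi \<beta> = (\<lambda>(i, j, k). diff_hyperplane i j k) ` ?D"
    unfolding extended_shi_def by (auto simp: image_iff)
  then have "card (regions (extended_shi \<beta>)) = sign_patterns ?D"
    by (simp only: card_regions_eq_sign_patterns)
  also have "hyperplanes_of ?D = hyperplanes_of ?G"
    unfolding hyperplanes_of_gap_arrangement
    by (auto simp: hyperplanes_of_def gap_arrangement_def gap_def neq_iff split: if_splits)
  then have "sign_patterns ?D = sign_patterns ?G"
    by (intro sign_patterns_cong) auto
  also have "\<dots> = ((\<Sum>j\<in>UNIV. (\<beta> j + 1)) + 1) ^ (CARD('n) - 1)"
    by (intro sign_patterns_shi) auto
  finally show ?thesis .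
qed

end
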